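(* Let $r$, $s$, $k$ be positive integers such that $r<s$, $\gcd(r,s)=1$, and $r+s$ divides $k$. Let $t\in\{0,1,\ldots,r+s-1\}$ be the unique integer with $\frac{sk}{r+s}-1+t\equiv 0 \pmod{r+s}$, and let $t'\in\{0,1,\ldots,r+s-1\}$ be the unique integer with $\frac{rk}{r+s}-1+t'\equiv 0\pmod{r+s}$. Then $$N(r,s,k)=\max\{k,M_1,M_2\},$$ where $$M_1=\begin{cases}\left(\frac{rsk}{(r+s)^2}-\frac{r+st}{r+s}\right)k+\frac{sk}{r+s}+t & \text{if } t\le r,\\[2mm] \left(\frac{rsk}{(r+s)^2}-\frac{r+r(r+s-t)}{r+s}\right)k+\frac{sk}{r+s}-(r+s-t) & \text{if } t>r,\end{cases}$$ and $$M_2=\begin{cases}\left(\frac{rsk}{(r+s)^2}-\frac{s+rt'}{r+s}\right)k+\frac{rk}{r+s}+t' & \text{if } t'\le s,\\[2mm] \left(\frac{rsk}{(r+s)^2}-\frac{s+s(r+s-t')}{r+s}\right)k+\frac{rk}{r+s}-(r+s-t') & \text{if } t'>s.\end{cases}$$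
   Context: For a positive integer $n$, $[n]=\{1,2,\ldots,n\}$. For a function $f:X\to\mathbb Z$ and $Y\subseteq X$, write $f(Y)=\sum_{y\in Y}f(y)$; $Y$ is a zero-sum set if $f(Y)=0$. A $k$-block is a set of $k$ consecutive integers; a zero-sum $k$-block is a $k$-block $B$ with $f(B)=0$. For positive integers $r,s,k$ with $r+s\mid k$, $N(r,s,k)$ denotes the minimum integer $N$ such that for every $n\ge N$, every function $f:[n]\to\{-r,s\}$ with $f([n])=0$ has a zero-sum $k$-block $B\subseteq[n]$.
   Formalization: N(r,s,k) is taken as the minimum over integers N ≥ k; without this bound the formula fails whenever the maximum is k (e.g. r=1, s=2, k=3: n=1,2 hold vacuously, so the minimum is at most 1, not 3); when M_1 or M_2 exceeds k both definitions agree. *)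

theory Defs
  imports Complex_Main "HOL-Library.FuncSet" "HOL-Number_Theory.Cong"
begin

definition zero_sum :: "(nat \<Rightarrow> int) \<Rightarrow> nat set \<Rightarrow> bool" where
  "zero_sum f Y \<longleftrightarrow> sum f Y = 0"

text \<open>
  Blocks are only ever used as subsets of \<open>[n] = {1..n}\<close>, so it is harmless to let them
  consist of natural numbers rather than integers.
\<close>

definition is_block :: "nat \<Rightarrow> nat set \<Rightarrow> bool" where
  "is_block k B \<longleftrightarrow> (\<exists>a. B = {a..<a + k})"

definition forces_zero_sum_block :: "nat \<Rightarrow> nat \<Rightarrow> nat \<Rightarrow> nat \<Rightarrow> bool" where
  "forces_zero_sum_block r s k n \<longleftrightarrow>
     (\<forall>f. f \<in> {1..n} \<rightarrow> {- int r, int s} \<and> zero_sum f {1..n} \<longrightarrow>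
          (\<exists>B. is_block k B \<and> B \<subseteq> {1..n} \<and> zero_sum f B))"

text \<open>
  The number \<open>N(r,s,k)\<close>.  The minimum is over \<open>N \<ge> k\<close>, i.e. over those \<open>N\<close> for which
  \<open>[N]\<close> contains a \<open>k\<close>-block at all.  Without this convention the condition can hold vacuously
  for some \<open>n < k\<close>, because a function \<open>[n] \<rightarrow> {-r, s}\<close> of total sum zero exists only if
  \<open>(r + s) / gcd(r, s)\<close> divides \<open>n\<close>; for instance \<open>N(1,2,3)\<close> would become
  \<open>1\<close> instead of \<open>3\<close>.  \<open>LEAST\<close> is unspecified if there is no such \<open>N\<close>, so an equation for
  \<open>zs_number r s k\<close> can only be proved by also showing that such an \<open>N\<close> exists.
\<close>

definition zs_number :: "nat \<Rightarrow> nat \<Rightarrow> nat \<Rightarrow> nat" where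
  "zs_number r s k = (LEAST N. k \<le> N \<and> (\<forall>n\<ge>N. forces_zero_sum_block r s k n))"

definition M1 :: "nat \<Rightarrow> nat \<Rightarrow> nat \<Rightarrow> nat \<Rightarrow> real" where
  "M1 r s k t =
     (if t \<le> r
      then (real r * real s * real k / (real r + real s)\<^sup>2
              - (real r + real s * real t) / (real r + real s)) * real k
           + real s * real k / (real r + real s) + real t
      else (real r * real s * real k / (real r + real s)\<^sup>2
              - (real r + real r * (real r + real s - real t)) / (real r + real s)) * real k
           + real s * real k / (real r + real s) - (real r + real s - real t))"

definition M2 :: "nat \<Rightarrow> nat \<Rightarrow> nat \<Rightarrow> nat \<Rightarrow> real" where
  "M2 r s k t' =
     (if t' \<le> s
      then (real r * real s * real k / (real r + real s)\<^sup>2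
              - (real s + real r * real t') / (real r + real s)) * real k
           + real r * real k / (real r + real s) + real t'
      else (real r * real s * real k / (real r + real s)\<^sup>2
              - (real s + real s * (real r + real s - real t')) / (real r + real s)) * real k
           + real r * real k / (real r + real s) - (real r + real s - real t'))"

end

theory Submission
  imports Defs
begin

text \<open>
  Put \<open>d = r + s\<close> and \<open>k = d q\<close>. Block sums are multiples of \<open>d\<close> and change by \<open>0\<close> or \<open>\<plusminus>d\<close>
  when the block is shifted by one, so if no block has sum zero, then all of them are \<open>\<ge> d\<close> or
  all are \<open>\<le> -d\<close>; negating \<open>f\<close> and swapping \<open>r\<close> and \<open>s\<close> exchanges the two cases.
  If all block sums are \<open>\<ge> d\<close> and \<open>n = k u + v\<close> with \<open>v < k\<close>, split off \<open>u\<close> blocks: the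
  remaining \<open>v\<close> terms sum to at most \<open>-d u\<close>, but to at least \<open>-r v\<close>, and (completing them to
  a block) to at least \<open>d - s (k - v)\<close>. Hence \<open>d u \<le> r v\<close> and \<open>d u + d \<le> s (k - v)\<close>.
  Conversely, under these inequalities the \<open>k\<close>-periodic word \<open>(V W)\<^sup>u V\<close> with \<open>|V| = v\<close>,
  \<open>|V W| = k\<close>, sum \<open>-d u\<close> on \<open>V\<close> and \<open>d u + d\<close> on \<open>W\<close> has all block sums equal to \<open>d\<close>.
  With \<open>v = d w\<close> the largest such \<open>n = d (q u + w)\<close> is found by maximising
  \<open>u = min (r w) (s (q - w) - 1)\<close>, that is, at \<open>w\<close> next to \<open>(s q - 1) / d\<close>; this is \<open>M1 - 1\<close>.
\<close>

section \<open>Sums of two-valued functions over sets and blocks\<close>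

lemma sum_two_valued_bounds:
  fixes f :: "nat \<Rightarrow> int"
  assumes "f \<in> A \<rightarrow> {- int r, int s}"
  shows "- int r * int (card A) \<le> sum f A" "sum f A \<le> int s * int (card A)"
proof -
  have *: "- int r \<le> f x" "f x \<le> int s" if "x \<in> A" for x
    using funcset_mem[OF assms that] by auto
  show "- int r * int (card A) \<le> sum f A"
    using sum_bounded_below[of A "- int r" f] *(1) by (simp add: mult.commute)
  show "sum f A \<le> int s * int (card A)"
    using sum_bounded_above[of A f "int s"] *(2) by (simp add: mult.commute)
qed

text \<open>Both values are congruent to \<open>- r\<close> modulo \<open>r + s\<close>.\<close>

lemma sum_two_valued_dvd:
  fixes f :: "nat \<Rightarrow> int"
  assumes "f \<in> A \<rightarrow> {- int r, int s}"
  shows "int (r + s) dvd sum f A + int r * int (card A)"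
proof -
  have "sum f A + int r * int (card A) = (\<Sum>x\<in>A. f x + int r)"
    by (simp add: sum.distrib mult.commute)
  also have "int (r + s) dvd \<dots>"
  proof (rule dvd_sum)
    fix x assume "x \<in> A"
    then have "f x = - int r \<or> f x = int s" using assms by auto
    then show "int (r + s) dvd f x + int r" by (auto simp: add.commute)
  qed
  finally show ?thesis .
qed

lemma sum_block_dvd:
  fixes f :: "nat \<Rightarrow> int"
  assumes "f \<in> {1..n} \<rightarrow> {- int r, int s}" "r + s dvd k" "1 \<le> a" "a + k \<le> n + 1"
  shows "int (r + s) dvd sum f {a..<a + k}"
proof -
  have "f \<in> {a..<a + k} \<rightarrow> {- int r, int s}" using assms by (auto simp: Pi_iff)
  from sum_two_valued_dvd[OF this]
  have "int (r + s) dvd sum f {a..<a + k} + int r * int k" by simp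
  moreover have "int (r + s) dvd int r * int k" using assms(2) by (metis dvd_mult of_nat_dvd_iff)
  ultimately show ?thesis using dvd_add_left_iff by blast
qed

lemma sum_block_shift:
  fixes f :: "nat \<Rightarrow> int"
  shows "sum f {Suc a..<Suc a + k} = sum f {a..<a + k} - f a + f (a + k)"
proof -
  have "sum f {a..<Suc (a + k)} = sum f {a..<a + k} + f (a + k)" by simp
  moreover have "sum f {a..<Suc (a + k)} = f a + sum f {Suc a..<Suc (a + k)}"
    by (rule sum.atLeast_Suc_lessThan) simp
  ultimately show ?thesis by simp
qed

section \<open>Reduction to functions whose block sums all have one sign\<close>

text \<open>Only one sign is encoded: negating \<open>f\<close> turns negative block sums for
  \<open>r\<close>, \<open>s\<close> into positive ones for \<open>s\<close>,
  \<open>r\<close>.\<close>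

definition positive_blocks :: "nat \<Rightarrow> nat \<Rightarrow> nat \<Rightarrow> nat \<Rightarrow> bool" where
  "positive_blocks r s k n \<longleftrightarrow>
     (\<exists>f. f \<in> {1..n} \<rightarrow> {- int r, int s} \<and> zero_sum f {1..n} \<and>
          (\<forall>a. 1 \<le> a \<and> a + k \<le> n + 1 \<longrightarrow> 0 < sum f {a..<a + k}))"

lemma forces_iff_blocks:
  assumes "0 < k"
  shows "forces_zero_sum_block r s k n \<longleftrightarrow>
    (\<forall>f. f \<in> {1..n} \<rightarrow> {- int r, int s} \<and> zero_sum f {1..n} \<longrightarrow>
       (\<exists>a. 1 \<le> a \<and> a + k \<le> n + 1 \<and> sum f {a..<a + k} = 0))"
proof -
  have "{a..<a + k} \<subseteq> {1..n} \<longleftrightarrow> 1 \<le> a \<and> a + k \<le> n + 1" for a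
    using assms ivl_subset[of a "a + k" 1 "n + 1"]
    by (auto simp flip: atLeastLessThanSuc_atLeastAtMost)
  then show ?thesis
    unfolding forces_zero_sum_block_def is_block_def zero_sum_def by metis
qed

lemma forces_zero_sum_block_swap:
  assumes "0 < k" "forces_zero_sum_block r s k n"
  shows "forces_zero_sum_block s r k n"
  unfolding forces_iff_blocks[OF assms(1)]
proof (intro allI impI)
  fix f :: "nat \<Rightarrow> int"
  assume "f \<in> {1..n} \<rightarrow> {- int s, int r} \<and> zero_sum f {1..n}"
  then have "(\<lambda>i. - f i) \<in> {1..n} \<rightarrow> {- int r, int s}" "zero_sum (\<lambda>i. - f i) {1..n}"
    by (auto simp: zero_sum_def sum_negf Pi_iff)
  with assms(2)[unfolded forces_iff_blocks[OF assms(1)]]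
  obtain a where "1 \<le> a \<and> a + k \<le> n + 1 \<and> (\<Sum>i = a..<a + k. - f i) = 0" by blast
  then show "\<exists>a. 1 \<le> a \<and> a + k \<le> n + 1 \<and> sum f {a..<a + k} = 0"
    by (auto simp: sum_negf)
qed

lemma not_forces_if_positive_blocks:
  assumes "0 < k" "positive_blocks r s k n"
  shows "\<not> forces_zero_sum_block r s k n"
  using assms(2) unfolding positive_blocks_def forces_iff_blocks[OF assms(1)]
  by (metis less_irrefl)

text \<open>A discrete intermediate value argument: without a zero, block sums cannot change sign as
  the block moves through \<open>[n]\<close>.\<close>

lemma positive_blocks_if_not_forces:
  assumes "0 < k" "k \<le> n" "r + s dvd k" "\<not> forces_zero_sum_block r s k n"
  shows "positive_blocks r s k n \<or> positive_blocks s r k n"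
proof -
  obtain f where f: "f \<in> {1..n} \<rightarrow> {- int r, int s}" "zero_sum f {1..n}"
    and nz: "\<And>a. 1 \<le> a \<Longrightarrow> a + k \<le> n + 1 \<Longrightarrow> sum f {a..<a + k} \<noteq> 0"
    using assms(4) unfolding forces_iff_blocks[OF assms(1)] by blast
  have same_sign: "0 < sum f {a..<a + k} \<longleftrightarrow> 0 < sum f {1..<1 + k}"
    if "1 \<le> a" "a + k \<le> n + 1" for a
    using that
  proof (induction a rule: dec_induct)
    case base
    show ?case ..
  next
    case (step a)
    let ?x = "sum f {a..<a + k}" and ?y = "sum f {Suc a..<Suc a + k}"
    have "int (r + s) dvd ?x" "int (r + s) dvd ?y"
      by (rule sum_block_dvd[OF f(1) assms(3)]; use step in simp)+
    moreover have "?x \<noteq> 0" "?y \<noteq> 0"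
      by (rule nz; use step in simp)+
    \<comment> \<open>Both sums have absolute value at least \<open>r + s\<close>, so opposite signs
      would need a jump of at least \<open>2 * (r + s)\<close>, twice what one shift allows.\<close>
    ultimately have "int (r + s) \<le> \<bar>?x\<bar>" "int (r + s) \<le> \<bar>?y\<bar>"
      by (metis dvd_imp_le_int abs_of_nat)+
    moreover have "a \<in> {1..n}" "a + k \<in> {1..n}" using step assms(1) by auto
    then have "f a \<in> {- int r, int s}" "f (a + k) \<in> {- int r, int s}"
      by (simp_all only: funcset_mem[OF f(1)])
    then have "\<bar>?y - ?x\<bar> \<le> int (r + s)"
      unfolding sum_block_shift by auto
    ultimately have "0 < ?x \<longleftrightarrow> 0 < ?y" using \<open>?x \<noteq> 0\<close> \<open>?y \<noteq> 0\<close> by linarith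
    then show ?case using step by simp
  qed
  show ?thesis
  proof (cases "0 < sum f {1..<1 + k}")
    case True
    then have "positive_blocks r s k n"
      unfolding positive_blocks_def using f same_sign by blast
    then show ?thesis ..
  next
    case False
    have "sum f {a..<a + k} < 0" if "1 \<le> a" "a + k \<le> n + 1" for a
      using same_sign[OF that] nz[OF that] False by linarith
    moreover have "(\<lambda>i. - f i) \<in> {1..n} \<rightarrow> {- int s, int r}" "zero_sum (\<lambda>i. - f i) {1..n}"
      using f by (auto simp: zero_sum_def sum_negf Pi_iff)
    ultimately have "positive_blocks s r k n"
      unfolding positive_blocks_def by (intro exI[of _ "\<lambda>i. - f i"]) (simp add: sum_negf)
    then show ?thesis ..
  qed
qed

section \<open>Necessary conditions on the length\<close>

lemma positive_blocks_necessary: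
  assumes "0 < k" "k \<le> n" "coprime r s" "r + s dvd k" "positive_blocks r s k n"
  shows "r + s dvd n"
    and "(r + s) * (n div k) \<le> r * (n mod k)"
    and "(r + s) * (n div k) + (r + s) \<le> s * (k - n mod k)"
proof -
  define u v d where "u = n div k" and "v = n mod k" and "d = r + s"
  have n: "n = k * u + v" and v: "v < k" using assms by (simp_all add: u_def v_def)
  have "1 \<le> u" using assms by (simp add: u_def div_greater_zero_iff Suc_le_eq)
  then have ku: "k \<le> k * u" by simp
  obtain f where f: "f \<in> {1..n} \<rightarrow> {- int r, int s}" and zero: "sum f {1..n} = 0"
    and pos: "\<And>a. 1 \<le> a \<Longrightarrow> a + k \<le> n + 1 \<Longrightarrow> 0 < sum f {a..<a + k}"
    using assms(5) unfolding positive_blocks_def zero_sum_def by blast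
  have block: "int d \<le> sum f {a..<a + k}" if "1 \<le> a" "a + k \<le> n + 1" for a
    using sum_block_dvd[OF f assms(4) that] pos[OF that] zdvd_imp_le unfolding d_def by blast
  have "int (r + s) dvd int (r * n)"
    using sum_two_valued_dvd[OF f] zero by simp
  then have "r + s dvd r * n" by (simp only: of_nat_dvd_iff)
  moreover have "coprime (r + s) r"
    using assms(3) by (simp add: coprime_commute gcd_add1 coprime_iff_gcd_eq_1 gcd.commute)
  ultimately show "r + s dvd n" using coprime_dvd_mult_right_iff by blast
  have blocks: "int d * int j \<le> sum f {1..<1 + k * j}" if "j \<le> u" for j
    using that
  proof (induction j)
    case (Suc j)
    have "k * Suc j \<le> k * u" using Suc.prems by (intro mult_le_mono2)
    then have "int d \<le> sum f {1 + k * j..<1 + k * j + k}"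
      by (intro block) (simp_all add: n)
    moreover have "sum f {1..<1 + k * Suc j} =
        sum f {1..<1 + k * j} + sum f {1 + k * j..<1 + k * j + k}"
      by (subst sum.atLeastLessThan_concat) (simp_all add: algebra_simps)
    ultimately show ?case using Suc by (simp add: algebra_simps)
  qed simp
  define R where "R = sum f {1 + k * u..<1 + n}"
  have "sum f {1..<1 + k * u} + R = 0"
    unfolding R_def
    by (subst sum.atLeastLessThan_concat) (use zero n in \<open>simp_all add: atLeastLessThanSuc_atLeastAtMost\<close>)
  then have R: "int d * int u \<le> - R" using blocks[of u] by simp
  have "f \<in> {1 + k * u..<1 + n} \<rightarrow> {- int r, int s}" using f by (auto simp: Pi_iff)
  from sum_two_valued_bounds(1)[OF this] have "- int r * int v \<le> R"
    by (simp add: R_def n)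
  then have "int (d * u) \<le> int (r * v)" using R by simp
  then show "(r + s) * (n div k) \<le> r * (n mod k)"
    unfolding d_def u_def v_def of_nat_le_iff .
  \<comment> \<open>The last block of \<open>[n]\<close> consists of the \<open>k - v\<close>
    entries summed in \<open>?S\<close>, followed by the remainder summed in \<open>R\<close>. Its
    sum is at least \<open>d\<close> although \<open>R\<close> is at most \<open>- d * u\<close>, so
    \<open>?S\<close> has to be large.\<close>
  let ?S = "sum f {1 + n - k..<1 + k * u}"
  have "f \<in> {1 + n - k..<1 + k * u} \<rightarrow> {- int r, int s}"
    using f n assms(2) by (auto simp: Pi_iff)
  from sum_two_valued_bounds(2)[OF this] have "?S \<le> int s * int (k - v)"
    using ku v by (simp add: n)
  moreover have "?S + R = sum f {1 + n - k..<1 + n - k + k}"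
    unfolding R_def using ku v assms(2)
    by (subst sum.atLeastLessThan_concat) (simp_all add: n)
  moreover have "int d \<le> sum f {1 + n - k..<1 + n - k + k}"
    using assms(2) by (intro block) simp_all
  ultimately have "int (d * u + d) \<le> int (s * (k - v))" using R by simp
  then show "(r + s) * (n div k) + (r + s) \<le> s * (k - n mod k)"
    unfolding d_def u_def v_def of_nat_le_iff .
qed

section \<open>Periodic words attaining the conditions\<close>

text \<open>A shift by one drops and gains entries of the same residue modulo
  \<open>k\<close>.\<close>

lemma sum_periodic_block:
  fixes h :: "nat \<Rightarrow> int"
  shows "(\<Sum>i = a..<a + k. h (i mod k)) = sum h {0..<k}"
proof (induction a)
  case (Suc a)
  then show ?case using sum_block_shift[of "\<lambda>i. h (i mod k)" a k] by simp
qed simp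

lemma sum_periodic:
  fixes h :: "nat \<Rightarrow> int"
  assumes "v < k"
  shows "(\<Sum>i = 0..<k * u + v. h (i mod k)) = int u * sum h {0..<k} + sum h {0..<v}"
proof (induction u)
  case 0
  then show ?case using assms by (simp cong: sum.cong_simp)
next
  case (Suc u)
  let ?h = "\<lambda>i. h (i mod k)"
  \<comment> \<open>The extra period is split off at the end. It is a window not aligned with
    multiples of \<open>k\<close>, which \<open>sum_periodic_block\<close> handles.\<close>
  have eq: "sum ?h {0..<k * Suc u + v} = sum ?h {0..<k * u + v} + sum ?h {k * u + v..<k * u + v + k}"
    by (subst sum.atLeastLessThan_concat) (simp_all add: algebra_simps)
  show ?case unfolding eq sum_periodic_block Suc.IH by (simp add: algebra_simps)
qed

lemma sum_step_function:
  assumes "c \<le> l"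
  shows "(\<Sum>i = a..<a + l. if i < a + c then int s else - int r) =
    int (r + s) * int c - int r * int l"
proof -
  let ?g = "\<lambda>i. if i < a + c then int s else - int r"
  have "sum ?g {a..<a + l} = sum ?g {a..<a + c} + sum ?g {a + c..<a + l}"
    using assms by (subst sum.atLeastLessThan_concat) simp_all
  also have "sum ?g {a..<a + c} = (\<Sum>i = a..<a + c. int s)" by (intro sum.cong) auto
  also have "sum ?g {a + c..<a + l} = (\<Sum>i = a + c..<a + l. - int r)" by (intro sum.cong) auto
  finally show ?thesis using assms by (simp add: algebra_simps of_nat_diff)
qed

lemma positive_blocks_sufficient:
  assumes "0 < r" "w < q" "u \<le> r * w" "u + 1 \<le> s * (q - w)"
  shows "positive_blocks r s ((r + s) * q) ((r + s) * (q * u + w))"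
proof -
  define d where "d = r + s"
  define k v where "k = d * q" and "v = d * w"
  have d: "0 < d" using assms by (simp add: d_def)
  have v: "v < k" using assms d by (simp add: v_def k_def)
  have n: "d * (q * u + w) = k * u + v" by (simp add: k_def v_def algebra_simps)
  \<comment> \<open>These are the numbers of entries \<open>s\<close> in \<open>V\<close> and
    \<open>W\<close>, found by solving \<open>d * c - r * v = - d * u\<close> and
    \<open>d * e - r * d * (q - w) = d * u + d\<close>. The assumed inequalities say that both
    counts are feasible.\<close>
  define c e where "c = r * w - u" and "e = u + 1 + r * (q - w)"
  have c: "c \<le> v" by (simp add: c_def v_def d_def algebra_simps)
  have kv: "k = v + d * (q - w)" using assms(2)
    by (simp add: k_def v_def flip: distrib_left)
  have e: "e \<le> d * (q - w)" using assms(4) by (simp add: e_def d_def algebra_simps)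
  define h where "h i = (if i < v then if i < c then int s else - int r
    else if i < v + e then int s else - int r)" for i
  have "sum h {0..<v} = (\<Sum>i = 0..<0 + v. if i < 0 + c then int s else - int r)"
    by (intro sum.cong) (auto simp: h_def)
  also have "\<dots> = int d * int c - int r * int v"
    unfolding d_def by (rule sum_step_function[OF c])
  also have "\<dots> = - (int d * int u)"
    using assms(3) by (simp add: c_def v_def of_nat_diff algebra_simps)
  finally have hv: "sum h {0..<v} = - (int d * int u)" .
  have "sum h {v..<k} = (\<Sum>i = v..<v + d * (q - w). if i < v + e then int s else - int r)"
    unfolding kv by (intro sum.cong) (auto simp: h_def)
  also have "\<dots> = int d * int e - int r * int (d * (q - w))"
    unfolding d_def by (rule sum_step_function[OF e[unfolded d_def]])
  also have "\<dots> = int d * int u + int d"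
  proof -
    have "int d * int (u + 1 + r * x) - int r * int (d * x) = int d * int u + int d" for x
      by (simp add: algebra_simps)
    then show ?thesis unfolding e_def .
  qed
  finally have hk: "sum h {0..<k} = int d"
    using hv sum.atLeastLessThan_concat[of 0 v k h] v by simp
  \<comment> \<open>Positions in \<open>[n]\<close> start at 1, residues at 0.\<close>
  define f where "f i = h ((i - 1) mod k)" for i
  have shift: "sum f {Suc a..<Suc b} = (\<Sum>i = a..<b. h (i mod k))" for a b
    unfolding sum.shift_bounds_Suc_ivl by (simp add: f_def)
  have "sum f {1..k * u + v} = 0"
    using shift[of 0 "k * u + v"] sum_periodic[OF v, of h u] hv hk
    by (simp add: atLeastLessThanSuc_atLeastAtMost)
  moreover have "0 < sum f {a..<a + k}" if "1 \<le> a" for a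
    using shift[of "a - 1" "a - 1 + k"] that sum_periodic_block[of h k "a - 1"] hk d by simp
  moreover have "f \<in> {1..k * u + v} \<rightarrow> {- int r, int s}" by (auto simp: f_def h_def)
  ultimately have "positive_blocks r s k (d * (q * u + w))"
    unfolding positive_blocks_def zero_sum_def n by blast
  then show ?thesis unfolding k_def d_def .
qed

section \<open>The closed formula and the optimisation behind it\<close>

text \<open>Identifies the two branches of \<open>M1\<close> with the two candidates
  \<open>W\<close> and \<open>W - 1\<close> for the optimal \<open>w\<close>; the final
  \<open>+ 1\<close> passes from the longest bad length to the threshold.\<close>

lemma M1_eq_int:
  fixes r s q t :: nat and W :: int
  assumes "0 < r" "int s * int q - 1 + int t = int (r + s) * W"
  defines "w \<equiv> (if t \<le> r then W else W - 1)"
    and "u \<equiv> (if t \<le> r then int s * (int q - W) - 1 else int r * (W - 1))"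
  shows "M1 r s ((r + s) * q) t = of_int (int (r + s) * (int q * u + w) + 1)"
proof -
  have d: "real r + real s \<noteq> 0" using assms by linarith
  have W: "real s * real q = (real r + real s) * of_int W + 1 - real t"
  proof -
    have "of_int (int s * int q - 1 + int t) = (of_int (int (r + s) * W) :: real)"
      using assms(2) by simp
    then show ?thesis by simp
  qed
  \<comment> \<open>This is \<open>r + s\<close> times the value of \<open>u\<close> for
    \<open>t \<le> r\<close>, with \<open>W\<close> eliminated.\<close>
  have W2: "(real r + real s) * (real s * (real q - of_int W) - 1) =
      real r * (real s * real q) - real s * real t - real r"
  proof -
    have "(real r + real s) * (real s * (real q - of_int W) - 1) =
      real s * ((real r + real s) * real q - (real r + real s) * of_int W) - (real r + real s)"
      by (simp add: algebra_simps)
    also have "(real r + real s) * of_int W = real s * real q - 1 + real t"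
      using W by simp
    finally show ?thesis by (simp add: algebra_simps)
  qed
  \<comment> \<open>Applied with \<open>D = r + s\<close> and \<open>z = q\<close>, this clears all
    denominators of \<open>M1\<close>.\<close>
  have cancel: "(x * (D * z) / D\<^sup>2 - y / D) * (D * z) = (x * z - y) * z"
    if "D \<noteq> 0" for x y z D :: real
    using that by (simp add: power2_eq_square field_simps)
  have cancel': "x * (D * z) / D = x * z" if "D \<noteq> 0" for x z D :: real
    using that by simp
  show ?thesis
  proof (cases "t \<le> r")
    case True
    have "M1 r s ((r + s) * q) t =
      (real r * (real s * real q) - real s * real t - real r) * real q + real s * real q + real t"
      using True unfolding M1_def of_nat_mult of_nat_add cancel[OF d] cancel'[OF d]
      by (simp add: algebra_simps)
    also have "\<dots> = of_int (int (r + s) * (int q * u + w) + 1)"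
      using True W unfolding W2[symmetric] by (simp add: w_def u_def algebra_simps)
    finally show ?thesis .
  next
    case False
    have "M1 r s ((r + s) * q) t =
      (real r * (real s * real q) - real r - real r * (real r + real s - real t)) * real q
        + real s * real q - (real r + real s - real t)"
      using False unfolding M1_def of_nat_mult of_nat_add cancel[OF d] cancel'[OF d]
      by (simp add: algebra_simps)
    also have "\<dots> = real r * (real s * real q + real t - 1 - (real r + real s)) * real q
        + (real s * real q + real t - 1 - (real r + real s)) + 1"
      by (simp add: algebra_simps)
    also have "real s * real q + real t - 1 - (real r + real s) =
        (real r + real s) * (of_int W - 1)"
      using W by (simp add: algebra_simps)
    also have "real r * \<dots> * real q + \<dots> + 1 = of_int (int (r + s) * (int q * u + w) + 1)"
      using False by (simp add: w_def u_def algebra_simps)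
    finally show ?thesis .
  qed
qed

text \<open>As \<open>w < q\<close>, maximising \<open>q * u + w\<close> means maximising
  \<open>u\<close> first and \<open>w\<close> second. The bound \<open>r * w\<close> increases and
  \<open>s * (q - w) - 1\<close> decreases in \<open>w\<close>, so the best \<open>u\<close> occurs
  at \<open>W\<close> or \<open>W - 1\<close>. The value \<open>r * (W - 1)\<close> exceeds
  \<open>s * (q - W) - 1\<close> by \<open>t - r\<close>, whence the case split; a tie at
  \<open>t = r\<close> goes to the larger \<open>w\<close>.\<close>

lemma lex_maximum:
  fixes r s q t W :: int
  assumes pos: "0 < r" "0 < s" "0 < q" and t: "0 \<le> t" "t < r + s"
    and W: "s * q - 1 + t = (r + s) * W"
  defines "w0 \<equiv> (if t \<le> r then W else W - 1)"
    and "u0 \<equiv> (if t \<le> r then s * (q - W) - 1 else r * (W - 1))"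
  shows "0 \<le> w0" "w0 < q" "u0 \<le> r * w0" "u0 + 1 \<le> s * (q - w0)"
    and "\<And>u w. 0 \<le> w \<Longrightarrow> w < q \<Longrightarrow> u \<le> r * w \<Longrightarrow> u + 1 \<le> s * (q - w) \<Longrightarrow>
           q * u + w \<le> q * u0 + w0"
proof -
  have sq: "0 < s * q" "0 < r * q" using pos by simp_all
  have "0 \<le> (r + s) * W" using sq t W by linarith
  then have W0: "0 \<le> W" using pos by (simp add: zero_le_mult_iff)
  have W1: "1 \<le> W" if "r < t"
  proof -
    have "0 < (r + s) * W" using that sq t pos W by linarith
    then show ?thesis using pos by (simp add: zero_less_mult_iff)
  qed
  \<comment> \<open>The two bounds \<open>r w\<close> and \<open>s (q - w) - 1\<close> on \<open>u\<close> differ by exactly \<open>t\<close> at \<open>w = W\<close>.\<close>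
  have gap: "r * W = s * (q - W) - 1 + t" using W by (simp add: algebra_simps)
  show "0 \<le> w0" by (cases "t \<le> r") (use W0 W1 in \<open>simp_all add: w0_def\<close>)
  show "w0 < q"
  proof -
    have "(r + s) * w0 < (r + s) * q"
    proof (cases "t \<le> r")
      case True
      have "r * 1 \<le> r * q" using pos by (intro mult_left_mono) auto
      then show ?thesis using W True by (simp add: w0_def algebra_simps)
    next
      case False
      then show ?thesis using W t sq by (simp add: w0_def algebra_simps)
    qed
    then show ?thesis using pos by simp
  qed
  show "u0 \<le> r * w0" using gap t by (simp add: u0_def w0_def)
  show "u0 + 1 \<le> s * (q - w0)" using gap t by (simp add: u0_def w0_def algebra_simps)
  fix u w assume uw: "0 \<le> w" "w < q" "u \<le> r * w" "u + 1 \<le> s * (q - w)"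
  \<comment> \<open>One unit of \<open>u\<close> is worth \<open>q\<close>, more than any admissible
    \<open>w\<close>.\<close>
  have less: "q * u + w \<le> q * u0 + w0" if "u < u0"
  proof -
    have "q * (u + 1) \<le> q * u0" using that pos by (intro mult_left_mono) auto
    then show ?thesis using uw \<open>0 \<le> w0\<close> by (simp add: algebra_simps)
  qed
  have le: "q * u + w \<le> q * u0 + w0" if "u \<le> u0" "w \<le> w0"
    using that pos by (simp add: add_mono)
  have *: "r * w \<le> r * (W - 1)" if "w < W" using that pos by simp
  have **: "s * (q - w) \<le> s * (q - W)" if "W \<le> w" using that pos by simp
  have ***: "s * (q - w) \<le> s * (q - (W + 1))" if "W < w"
    using that pos by (intro mult_left_mono) auto
  show "q * u + w \<le> q * u0 + w0"
  proof (cases "t \<le> r")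
    case True
    consider "w < W" | "w = W" | "W < w" by linarith
    then show ?thesis
    proof cases
      case 1
      then show ?thesis using * gap uw True
        by (intro le) (simp_all add: u0_def w0_def algebra_simps)
    next
      case 2
      then show ?thesis using uw True by (intro le) (simp_all add: u0_def w0_def)
    next
      case 3
      then show ?thesis using *** uw True pos
        by (intro less) (simp add: u0_def algebra_simps)
    qed
  next
    case False
    show ?thesis
    proof (cases "w < W")
      case True
      then show ?thesis using * uw False by (intro le) (simp_all add: u0_def w0_def)
    next
      case False
      then show ?thesis using ** gap uw \<open>\<not> t \<le> r\<close>
        by (intro less) (simp add: u0_def algebra_simps)
    qed
  qed
qed

section \<open>The extremal length and the value of \<open>N(r,s,k)\<close>\<close>

text \<open>Attainment is claimed only for \<open>m\<close> above \<open>k\<close>: if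
  \<open>u0 = 0\<close>, the optimal length \<open>d * w0\<close> is below \<open>k\<close>, and no
  block fits into it.\<close>

lemma positive_blocks_extremal:
  fixes r s q t :: nat
  assumes pos: "0 < r" "0 < s" "0 < q" and cop: "coprime r s" and t: "t < r + s"
    and cong: "[int s * int q - 1 + int t = 0] (mod int (r + s))"
  obtains m :: int where "M1 r s ((r + s) * q) t = of_int m"
    and "\<And>n. (r + s) * q \<le> n \<Longrightarrow> positive_blocks r s ((r + s) * q) n \<Longrightarrow> int n < m"
    and "int ((r + s) * q) < m \<Longrightarrow>
           \<exists>n. (r + s) * q \<le> n \<and> int n + 1 = m \<and> positive_blocks r s ((r + s) * q) n"
proof -
  define d where "d = r + s"
  have d: "0 < d" using pos by (simp add: d_def)
  obtain W where W: "int s * int q - 1 + int t = int (r + s) * W"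
    using cong by (auto simp: cong_0_iff elim: dvdE)
  define w0 where "w0 = (if t \<le> r then W else W - 1)"
  define u0 where "u0 = (if t \<le> r then int s * (int q - W) - 1 else int r * (W - 1))"
  have "int s * int q - 1 + int t = (int r + int s) * W" using W by simp
  note lex = lex_maximum[OF _ _ _ _ _ this, simplified, folded u0_def w0_def]
  have l: "0 \<le> w0" "w0 < int q" "u0 \<le> int r * w0" "u0 + 1 \<le> int s * (int q - w0)"
    using lex(1-4) pos t by (simp_all add: of_nat_add[symmetric] del: of_nat_add)
  have l5: "int q * u + w \<le> int q * u0 + w0"
    if "0 \<le> w" "w < int q" "u \<le> int r * w" "u + 1 \<le> int s * (int q - w)" for u w
    using lex(5) that pos t by (simp add: of_nat_add[symmetric] del: of_nat_add)
  show thesis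
  proof (rule that[of "int d * (int q * u0 + w0) + 1"])
    show "M1 r s ((r + s) * q) t = of_int (int d * (int q * u0 + w0) + 1)"
      unfolding u0_def w0_def d_def by (rule M1_eq_int[OF pos(1) W])
  next
    fix n assume n: "(r + s) * q \<le> n" "positive_blocks r s ((r + s) * q) n"
    define u where "u = n div (d * q)"
    have dq: "0 < d * q" using d pos by simp
    note nec = positive_blocks_necessary[OF dq[unfolded d_def] n(1) cop _ n(2), folded d_def]
    obtain m where m: "n = d * m" using nec(1) by auto
    define w where "w = m mod q"
    have u: "u = m div q" using d by (simp add: u_def m)
    \<comment> \<open>Since \<open>n = d * m\<close>, the common factor \<open>d\<close> leaves
      quotient and remainder of \<open>m\<close> by \<open>q\<close>.\<close>
    have v: "n mod (d * q) = d * w" using d by (simp only: m w_def mult_mod_right)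
    have w: "w < q" using pos by (simp add: w_def)
    have "d * u \<le> d * (r * w)" using nec(2) by (simp add: v u_def algebra_simps)
    then have 1: "u \<le> r * w" using d by simp
    have "d * (u + 1) \<le> d * (s * (q - w))"
      using nec(3) by (simp add: v u_def algebra_simps)
    then have 2: "u + 1 \<le> s * (q - w)" using d by (simp only: mult_le_cancel1)
    have "int q * int u + int w \<le> int q * u0 + w0"
    proof (rule l5)
      show "int u \<le> int r * int w" using 1 by (simp flip: of_nat_mult)
      have "int (u + 1) \<le> int (s * (q - w))" using 2 by (simp only: of_nat_le_iff)
      then show "int u + 1 \<le> int s * (int q - int w)" using w by (simp add: of_nat_diff)
    qed (use w in simp_all)
    moreover have "int m = int q * int u + int w"
      unfolding u w_def by (simp flip: of_nat_mult of_nat_add)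
    ultimately have "int d * int m \<le> int d * (int q * u0 + w0)"
      by (simp add: mult_left_mono)
    then show "int n < int d * (int q * u0 + w0) + 1" by (simp add: m)
  next
    assume "int ((r + s) * q) < int d * (int q * u0 + w0) + 1"
    then have "int d * int q \<le> int d * (int q * u0 + w0)" by (simp add: d_def)
    then have ge: "int q \<le> int q * u0 + w0" using d by simp
    \<comment> \<open>Because \<open>w0 < q\<close>, a length of at least \<open>k\<close> forces
      \<open>u0\<close> to be positive.\<close>
    then have "int q * 0 < int q * u0" using l(2) by simp
    then have "0 < u0" using pos by (simp only: mult_less_cancel_left_pos of_nat_0_less_iff)
    then obtain u w where u: "u0 = int u" and w: "w0 = int w"
      using l(1) by (metis less_le nonneg_int_cases)
    have "positive_blocks r s ((r + s) * q) ((r + s) * (q * u + w))"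
    proof (rule positive_blocks_sufficient)
      show "w < q" using l(2) w by simp
      show "u \<le> r * w" using l(3) unfolding u w by (simp flip: of_nat_mult)
      have "int (u + 1) \<le> int (s * (q - w))" using l(4) \<open>w < q\<close> unfolding u w
        by (simp add: of_nat_diff)
      then show "u + 1 \<le> s * (q - w)" by (simp only: of_nat_le_iff)
    qed (use pos in simp)
    moreover have "q \<le> q * u + w" using ge unfolding u w by (simp flip: of_nat_mult of_nat_add)
    then have "(r + s) * q \<le> (r + s) * (q * u + w)" by (rule mult_le_mono2)
    moreover have "int ((r + s) * (q * u + w)) + 1 = int d * (int q * u0 + w0) + 1"
      by (simp add: d_def u w)
    ultimately show "\<exists>n. (r + s) * q \<le> n \<and> int n + 1 = int d * (int q * u0 + w0) + 1 \<and>
        positive_blocks r s ((r + s) * q) n" by blast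
  qed
qed

text \<open>Lets the negative block sums be treated by the result for positive ones with
  \<open>r\<close> and \<open>s\<close> exchanged.\<close>

lemma M2_eq_M1_swap: "M2 r s k t = M1 s r k t"
  by (simp add: M1_def M2_def algebra_simps)

theorem theorem1p9:
  fixes r s k t t' :: nat
  assumes "0 < r" and "0 < s" and "0 < k"
    and "r < s" and "gcd r s = 1" and "r + s dvd k"
    and "t \<in> {0..r + s - 1}"
    and "[int (s * k div (r + s)) - 1 + int t = 0] (mod int (r + s))"
    and "t' \<in> {0..r + s - 1}"
    and "[int (r * k div (r + s)) - 1 + int t' = 0] (mod int (r + s))"
  shows "real (zs_number r s k) = Max {real k, M1 r s k t, M2 r s k t'}"
proof -
  obtain q where k: "k = (r + s) * q" using assms(6) by auto
  have q: "0 < q" using assms(3) by (simp add: k)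
  have cop: "coprime r s" "coprime s r" using assms(5) by (simp_all add: coprime_iff_gcd_eq_1 gcd.commute)
  have div: "x * k div (r + s) = x * q" for x
  proof -
    have "x * k = (r + s) * (x * q)" by (simp add: k)
    then show ?thesis using assms(1) by (simp only: nonzero_mult_div_cancel_left)
  qed
  have t: "t < r + s" "t' < s + r" using assms by auto
  have c1: "[int s * int q - 1 + int t = 0] (mod int (r + s))" using assms(8) by (simp add: div)
  have c2: "[int r * int q - 1 + int t' = 0] (mod int (s + r))"
    using assms(10) by (simp add: div add.commute)
  have k': "k = (s + r) * q" by (simp add: k add.commute)
  obtain m1 where m1: "M1 r s k t = of_int m1"
    and up1: "\<And>n. k \<le> n \<Longrightarrow> positive_blocks r s k n \<Longrightarrow> int n < m1"
    and ex1: "int k < m1 \<Longrightarrow> \<exists>n. k \<le> n \<and> int n + 1 = m1 \<and> positive_blocks r s k n"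
    using positive_blocks_extremal[OF assms(1,2) q cop(1) t(1) c1, folded k] by blast
  obtain m2 where m2: "M2 r s k t' = of_int m2"
    and up2: "\<And>n. k \<le> n \<Longrightarrow> positive_blocks s r k n \<Longrightarrow> int n < m2"
    and ex2: "int k < m2 \<Longrightarrow> \<exists>n. k \<le> n \<and> int n + 1 = m2 \<and> positive_blocks s r k n"
    using positive_blocks_extremal[OF assms(2,1) q cop(2) t(2) c2, folded k' M2_eq_M1_swap] by blast
  define m where "m = max (int k) (max m1 m2)"
  have "zs_number r s k = nat m"
    unfolding zs_number_def
  proof (rule Least_equality, intro conjI allI impI)
    show "k \<le> nat m" by (simp add: m_def)
    fix n assume "nat m \<le> n"
    then have n: "m1 \<le> int n" "m2 \<le> int n" "k \<le> n" by (simp_all add: m_def)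
    show "forces_zero_sum_block r s k n"
    proof (rule ccontr)
      assume "\<not> forces_zero_sum_block r s k n"
      then have "positive_blocks r s k n \<or> positive_blocks s r k n"
        by (rule positive_blocks_if_not_forces[OF assms(3) n(3) assms(6)])
      then show False using up1[OF n(3)] up2[OF n(3)] n by linarith
    qed
  next
    fix N assume N: "k \<le> N \<and> (\<forall>n\<ge>N. forces_zero_sum_block r s k n)"
    \<comment> \<open>Forcing is symmetric in \<open>r\<close> and \<open>s\<close>, so both signs
      are excluded from \<open>N\<close> on.\<close>
    have none: "\<not> positive_blocks r s k n" "\<not> positive_blocks s r k n" if "N \<le> n" for n
      using N that not_forces_if_positive_blocks[OF assms(3)]
        forces_zero_sum_block_swap[OF assms(3)] by blast+
    \<comment> \<open>Stated for general \<open>x\<close> and \<open>P\<close> to serve both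
      \<open>m1\<close> and \<open>m2\<close>. If \<open>x\<close> exceeded \<open>N\<close>, it
      would exceed \<open>k\<close>, and the bad length \<open>x - 1\<close> would be at least
      \<open>N\<close>.\<close>
    have "x \<le> int N"
      if "int k < x \<Longrightarrow> \<exists>n. k \<le> n \<and> int n + 1 = x \<and> P n" "\<And>n. N \<le> n \<Longrightarrow> \<not> P n" for x P
    proof (rule ccontr)
      assume "\<not> x \<le> int N"
      moreover from this that(1) N obtain n where "int n + 1 = x" "P n" by force
      ultimately show False using that(2)[of n] by simp
    qed
    from this[OF ex1, OF _ none(1)] this[OF ex2, OF _ none(2)]
    have "m1 \<le> int N" "m2 \<le> int N" by blast+
    then show "nat m \<le> N" using N by (simp add: m_def nat_le_iff)
  qed
  then have "real (zs_number r s k) = of_int m" by (simp add: m_def)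
  then show ?thesis by (simp add: m1 m2 m_def)
qed

end
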